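(* Let $(X,\rho,\mu)$ be a $K$-doubling metric measure space, $(M,d)$ a complete metric space and $\mathcal D$ an approximate $X$-distribution for $M$. If $\mathcal D$ is differentiably complete, then for every nonempty $A\subseteq X$ every function $f\colon A\to M$ is a.e. approximately $\mathcal D$-differentiable on $A_f^\mu$. Conversely, if every function $f\colon X\to M$ is a.e. approximately $\mathcal D$-differentiable on $A_f^\mu$, then $\mathcal D$ is differentiably complete.
   Context: A $K$-doubling metric measure space ($K>0$) is a triple $(X,\rho,\mu)$ where $(X,\rho)$ is a complete separable metric space and $\mu$ is a Borel-regular outer measure on $X$ with $0<\mu(B_{2r}(x))\le K\mu(B_r(x))<+\infty$ for all $x\in X$, $r>0$. A set $E\ni x$ is a $\mu$-neighborhood of $x$ if there is a Borel set $B\subseteq E$ with $\lim_{r\to0^+}\mu(B_r(x)\setminus B)/\mu(B_r(x))=0$. A point $x$ is a $\mu$-accumulation point of $A$ if $A\cap U\setminus\{x\}\ne\emptyset$ for every $\mu$-neighborhood $U$ of $x$; for such $x$ and $g\colon A\to\mathbb R$, $\mu\text{-}\lim_{y\in A,y\to x}g(y)=z$ means that for every $\varepsilon>0$ there is a $\mu$-neighborhood $U$ of $x$ with $|g(y)-z|<\varepsilon$ for $y\in A\cap U\setminus\{x\}$, and $\mu\text{-}\limsup_{y\in A,y\to x}g(y)=\inf_U\sup_{y\in U\cap A\setminus\{x\}}g(y)$ over $\mu$-neighborhoods $U$ of $x$. For $x\in X$, $P\in M$, $\mathcal C^\mu_{x,P}$ is the set of classes $[F]$ of Lipschitz maps $F\colon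 B\to M$ on a $\mu$-neighborhood $B$ of $x$ with $F(x)=P$, modulo $F\sim G\iff\mu\text{-}\lim_{y\to x}d(F(y),G(y))/\rho(y,x)=0$. An approximate $X$-distribution for $M$ is any subset $\mathcal D\subseteq\bigsqcup_{(x,P)}\mathcal C^\mu_{x,P}$, and $\mathcal D_{x,P}=\mathcal D\cap\mathcal C^\mu_{x,P}$. For $f\colon A\to M$ and a $\mu$-accumulation point $x\in A$ of $A$, $f$ is approximately $\mathcal D$-differentiable at $x$ if some $[F]\in\mathcal D_{x,f(x)}$ satisfies $\mu\text{-}\lim_{y\in A,y\to x}d(f(y),F(y))/\rho(y,x)=0$. $A_f^\mu$ is the set of $\mu$-accumulation points $x\in A$ of $A$ with $\mu\text{-}\limsup_{y\in A,y\to x}d(f(y),f(x))/\rho(y,x)<+\infty$. "$f$ is a.e. approximately $\mathcal D$-differentiable on $A_f^\mu$" means: for every $\mu$-measurable $B\subseteq A_f^\mu$, $f$ is approximately $\mathcal D$-differentiable at $\mu$-a.e. point of $B$. $\mathcal D$ is differentiably complete if for every nonempty closed set $C\subseteq X$ and every Lipschitz $g\colon C\to M$, $g$ is a.e. approximately $\mathcal D$-differentiable on $A_g^\mu$. *)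

theory Defs
  imports "HOL-Analysis.Analysis"
begin

definition mu_measurable :: "('a set \<Rightarrow> ennreal) \<Rightarrow> 'a set \<Rightarrow> bool" where
  "mu_measurable \<mu> B \<longleftrightarrow> (\<forall>E. \<mu> (E \<inter> B) + \<mu> (E - B) = \<mu> E)"

definition borel_regular_outer_measure :: "('a::topological_space set \<Rightarrow> ennreal) \<Rightarrow> bool" where
  "borel_regular_outer_measure \<mu> \<longleftrightarrow>
     \<mu> {} = 0 \<and>
     (\<forall>A B. A \<subseteq> B \<longrightarrow> \<mu> A \<le> \<mu> B) \<and>
     (\<forall>A :: nat \<Rightarrow> 'a set. \<mu> (\<Union>i. A i) \<le> (\<Sum>i. \<mu> (A i))) \<and>
     (\<forall>B \<in> sets borel. mu_measurable \<mu> B) \<and>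
     (\<forall>A. \<exists>B \<in> sets borel. A \<subseteq> B \<and> \<mu> B = \<mu> A)"

text \<open>(X, dist, mu) is a K-doubling metric measure space; completeness and separability of X
  are given by the type class polish_space.\<close>
definition doubling_mms :: "real \<Rightarrow> ('a::metric_space set \<Rightarrow> ennreal) \<Rightarrow> bool" where
  "doubling_mms K \<mu> \<longleftrightarrow> K > 0 \<and> borel_regular_outer_measure \<mu> \<and>
     (\<forall>x r. r > 0 \<longrightarrow> 0 < \<mu> (ball x (2 * r)) \<and> \<mu> (ball x (2 * r)) \<le> ennreal K * \<mu> (ball x r)
                      \<and> \<mu> (ball x r) < top)"

definition mu_nbhd :: "('a::metric_space set \<Rightarrow> ennreal) \<Rightarrow> 'a \<Rightarrow> 'a set \<Rightarrow> bool" where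
  "mu_nbhd \<mu> x E \<longleftrightarrow> x \<in> E \<and> (\<exists>B \<in> sets borel. B \<subseteq> E \<and>
     ((\<lambda>r. enn2real (\<mu> (ball x r - B)) / enn2real (\<mu> (ball x r))) \<longlongrightarrow> 0) (at_right 0))"

definition mu_acc :: "('a::metric_space set \<Rightarrow> ennreal) \<Rightarrow> 'a set \<Rightarrow> 'a \<Rightarrow> bool" where
  "mu_acc \<mu> A x \<longleftrightarrow> (\<forall>U. mu_nbhd \<mu> x U \<longrightarrow> A \<inter> U - {x} \<noteq> {})"

definition mu_lim :: "('a::metric_space set \<Rightarrow> ennreal) \<Rightarrow> 'a set \<Rightarrow> ('a \<Rightarrow> real) \<Rightarrow> 'a \<Rightarrow> real \<Rightarrow> bool" where
  "mu_lim \<mu> A g x z \<longleftrightarrow> (\<forall>\<epsilon>>0. \<exists>U. mu_nbhd \<mu> x U \<and> (\<forall>y \<in> A \<inter> U - {x}. \<bar>g y - z\<bar> < \<epsilon>))"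

definition mu_limsup :: "('a::metric_space set \<Rightarrow> ennreal) \<Rightarrow> 'a set \<Rightarrow> ('a \<Rightarrow> real) \<Rightarrow> 'a \<Rightarrow> ereal" where
  "mu_limsup \<mu> A g x = (INF U \<in> {U. mu_nbhd \<mu> x U}. SUP y \<in> U \<inter> A - {x}. ereal (g y))"

text \<open>A germ candidate: a Lipschitz map F on a mu-neighbourhood B of x with F x = P,
  represented as the pair (B, F) (values of F outside B are irrelevant).\<close>
definition germs :: "('a::metric_space set \<Rightarrow> ennreal) \<Rightarrow> 'a \<Rightarrow> 'b::metric_space \<Rightarrow> ('a set \<times> ('a \<Rightarrow> 'b)) set" where
  "germs \<mu> x P = {(B, F). mu_nbhd \<mu> x B \<and> (\<exists>L. L-lipschitz_on B F) \<and> F x = P}"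

definition germ_rel :: "('a::metric_space set \<Rightarrow> ennreal) \<Rightarrow> 'a \<Rightarrow> 'b::metric_space
    \<Rightarrow> (('a set \<times> ('a \<Rightarrow> 'b)) \<times> ('a set \<times> ('a \<Rightarrow> 'b))) set" where
  "germ_rel \<mu> x P = {((B, F), (B', G)). (B, F) \<in> germs \<mu> x P \<and> (B', G) \<in> germs \<mu> x P \<and>
      mu_lim \<mu> (B \<inter> B') (\<lambda>y. dist (F y) (G y) / dist y x) x 0}"

definition germ_classes :: "('a::metric_space set \<Rightarrow> ennreal) \<Rightarrow> 'a \<Rightarrow> 'b::metric_space
    \<Rightarrow> ('a set \<times> ('a \<Rightarrow> 'b)) set set" where
  "germ_classes \<mu> x P = germs \<mu> x P // germ_rel \<mu> x P"

text \<open>An approximate X-distribution: a subset of the disjoint union over (x,P) of C^mu_{x,P},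
  elements tagged by (x,P).\<close>
definition approx_distribution :: "('a::metric_space set \<Rightarrow> ennreal)
    \<Rightarrow> ('a \<times> 'b::metric_space \<times> ('a set \<times> ('a \<Rightarrow> 'b)) set) set \<Rightarrow> bool" where
  "approx_distribution \<mu> D \<longleftrightarrow> D \<subseteq> {(x, P, c). c \<in> germ_classes \<mu> x P}"

definition approx_D_diff_at :: "('a::metric_space set \<Rightarrow> ennreal)
    \<Rightarrow> ('a \<times> 'b::metric_space \<times> ('a set \<times> ('a \<Rightarrow> 'b)) set) set
    \<Rightarrow> 'a set \<Rightarrow> ('a \<Rightarrow> 'b) \<Rightarrow> 'a \<Rightarrow> bool" where
  "approx_D_diff_at \<mu> D A f x \<longleftrightarrow> x \<in> A \<and> mu_acc \<mu> A x \<and>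
     (\<exists>c. (x, f x, c) \<in> D \<and> (\<exists>(B, F) \<in> c.
        mu_lim \<mu> (A \<inter> B) (\<lambda>y. dist (f y) (F y) / dist y x) x 0))"

definition A_f_mu :: "('a::metric_space set \<Rightarrow> ennreal) \<Rightarrow> 'a set \<Rightarrow> ('a \<Rightarrow> 'b::metric_space) \<Rightarrow> 'a set" where
  "A_f_mu \<mu> A f = {x \<in> A. mu_acc \<mu> A x \<and>
      mu_limsup \<mu> A (\<lambda>y. dist (f y) (f x) / dist y x) x < \<infinity>}"

definition ae_approx_D_diff :: "('a::metric_space set \<Rightarrow> ennreal)
    \<Rightarrow> ('a \<times> 'b::metric_space \<times> ('a set \<times> ('a \<Rightarrow> 'b)) set) set
    \<Rightarrow> 'a set \<Rightarrow> ('a \<Rightarrow> 'b) \<Rightarrow> bool" where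
  "ae_approx_D_diff \<mu> D A f \<longleftrightarrow> (\<forall>B. B \<subseteq> A_f_mu \<mu> A f \<longrightarrow> mu_measurable \<mu> B \<longrightarrow>
      \<mu> {x \<in> B. \<not> approx_D_diff_at \<mu> D A f x} = 0)"

definition differentiably_complete :: "('a::metric_space set \<Rightarrow> ennreal)
    \<Rightarrow> ('a \<times> 'b::metric_space \<times> ('a set \<times> ('a \<Rightarrow> 'b)) set) set \<Rightarrow> bool" where
  "differentiably_complete \<mu> D \<longleftrightarrow> (\<forall>C (g :: 'a \<Rightarrow> 'b). C \<noteq> {} \<longrightarrow> closed C \<longrightarrow>
      (\<exists>L. L-lipschitz_on C g) \<longrightarrow> ae_approx_D_diff \<mu> D C g)"

end

theory Submission
  imports Defs
begin

text \<open>For the direct implication let \<open>B\<close> be a measurable subset of the finite-slope set.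
  By Lebesgue density \<open>B\<close> is, up to a null set, a countable union of bounded sets \<open>S\<close>
  on which \<open>f\<close> is Lipschitz, and \<open>f\<close> restricted to \<open>S\<close> extends to a Lipschitz map
  \<open>g\<close> on the closure of \<open>S\<close>. The set \<open>S\<close> need not be measurable, so it
  may fail to be a \<open>\<mu>\<close>-neighbourhood of any of its points. Still, a density point \<open>y \<in> B\<close>
  of a Borel hull \<open>H\<close> of \<open>S\<close> is approximated by points of \<open>S\<close> along which the slope of \<open>f\<close> at \<open>y\<close>
  stays bounded, so \<open>g y = f y\<close>. Hence \<open>f = g\<close> almost everywhere on \<open>H \<inter> B\<close>, which is a
  \<open>\<mu>\<close>-neighbourhood of almost every point of \<open>S\<close>, and differentiability passes from \<open>g\<close>
  to \<open>f\<close>. For the converse, a map that is Lipschitz on a closed set \<open>C\<close> has finite slope,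
  as a map on the whole space, at every density point of \<open>C\<close> that is an accumulation point.\<close>

subsection \<open>Borel regular outer measures and density points\<close>

text \<open>Greedy Vitali selection: keep a ball of largest radius, discard every ball that meets
  it, and recurse on the rest. A discarded ball is no larger than the kept one, so tripling the kept
  ball swallows it.\<close>

lemma finite_ball_subcover:
  fixes r :: "'a::metric_space \<Rightarrow> real"
  assumes "finite I"
  obtains J where "J \<subseteq> I" "disjoint_family_on (\<lambda>x. ball x (r x)) J"
    "(\<Union>x\<in>I. ball x (r x)) \<subseteq> (\<Union>x\<in>J. ball x (3 * r x))"
proof -
  have "\<exists>J\<subseteq>I. disjoint_family_on (\<lambda>x. ball x (r x)) J \<and>
      (\<Union>x\<in>I. ball x (r x)) \<subseteq> (\<Union>x\<in>J. ball x (3 * r x))"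
    using assms
  proof (induction I rule: finite_psubset_induct)
    case (psubset I)
    show ?case
    proof (cases "I = {}")
      case False
      have "Max (r ` I) \<in> r ` I"
        using False \<open>finite I\<close> by (intro Max_in) auto
      then obtain m where "m \<in> I" "r m = Max (r ` I)" by auto
      with \<open>finite I\<close> have m: "m \<in> I" "\<And>x. x \<in> I \<Longrightarrow> r x \<le> r m" by auto
      define I' where "I' = {x\<in>I - {m}. ball x (r x) \<inter> ball m (r m) = {}}"
      have "I' \<subseteq> I" "m \<notin> I'" by (auto simp: I'_def)
      then have "I' \<subset> I" using m(1) by auto
      obtain J where J: "J \<subseteq> I'" "disjoint_family_on (\<lambda>x. ball x (r x)) J"
        "(\<Union>x\<in>I'. ball x (r x)) \<subseteq> (\<Union>x\<in>J. ball x (3 * r x))"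
        using psubset.IH[OF \<open>I' \<subset> I\<close>] by auto
      have near: "ball x (r x) \<subseteq> ball m (3 * r m)" if x: "x \<in> I" "x \<notin> I'" for x
      proof
        fix y assume y: "y \<in> ball x (r x)"
        obtain z where z: "z \<in> ball x (r x)" "z \<in> ball m (r m)"
          using x y by (cases "x = m") (auto simp: I'_def)
        have "dist m y \<le> dist m z + dist x z + dist x y"
          using dist_triangle[of m y z] dist_triangle[of z y x] by (simp add: dist_commute)
        also have "\<dots> < 3 * r m" using y z m(2)[OF x(1)] by simp
        finally show "y \<in> ball m (3 * r m)" by simp
      qed
      have "disjoint_family_on (\<lambda>x. ball x (r x)) (insert m J)"
        using J(1,2) unfolding disjoint_family_on_def I'_def by (auto simp: Int_commute)
      moreover have "(\<Union>x\<in>I. ball x (r x)) \<subseteq> (\<Union>x\<in>insert m J. ball x (3 * r x))"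
      proof (rule UN_least)
        fix x assume "x \<in> I"
        show "ball x (r x) \<subseteq> (\<Union>x\<in>insert m J. ball x (3 * r x))"
        proof (cases "x \<in> I'")
          case True
          then have "ball x (r x) \<subseteq> (\<Union>x\<in>J. ball x (3 * r x))" using J(3) by blast
          then show ?thesis by blast
        next
          case False
          then show ?thesis using near[OF \<open>x \<in> I\<close>] by blast
        qed
      qed
      moreover have "insert m J \<subseteq> I"
        using J(1) \<open>I' \<subseteq> I\<close> m(1) by blast
      ultimately show ?thesis by blast
    qed (auto simp: disjoint_family_on_def)
  qed
  then show ?thesis using that by blast
qed

locale doubling_space =
  fixes K :: real and \<mu> :: "'a::polish_space set \<Rightarrow> ennreal"
  assumes doubling: "doubling_mms K \<mu>"
begin

section \<open>Null sets, measurable sets and Borel hulls of the outer measure\<close>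

lemma K_pos: "K > 0"
  using doubling by (simp add: doubling_mms_def)

lemma ball_pos: "r > 0 \<Longrightarrow> 0 < \<mu> (ball x r)"
  using doubling by (metis doubling_mms_def field_sum_of_halves half_gt_zero mult_2)

lemma ball_finite: "r > 0 \<Longrightarrow> \<mu> (ball x r) < top"
  using doubling by (simp add: doubling_mms_def)

lemma ball_double: "r > 0 \<Longrightarrow> \<mu> (ball x (2 * r)) \<le> ennreal K * \<mu> (ball x r)"
  using doubling by (simp add: doubling_mms_def)

lemma outer: "borel_regular_outer_measure \<mu>"
  using doubling by (simp add: doubling_mms_def)

lemma mu_empty [simp]: "\<mu> {} = 0"
  using outer by (simp add: borel_regular_outer_measure_def)

lemma mu_mono: "A \<subseteq> B \<Longrightarrow> \<mu> A \<le> \<mu> B"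
  using outer by (simp add: borel_regular_outer_measure_def)

lemma mu_UN: "\<mu> (\<Union>i::nat. A i) \<le> (\<Sum>i. \<mu> (A i))"
  using outer by (simp add: borel_regular_outer_measure_def)

lemma mu_Un: "\<mu> (A \<union> B) \<le> \<mu> A + \<mu> B"
  using mu_UN[of "binaryset A B"]
  by (simp add: UN_binaryset_eq suminf_binaryset_eq)

lemma mu_UN_finite: "finite I \<Longrightarrow> \<mu> (\<Union>i\<in>I. A i) \<le> (\<Sum>i\<in>I. \<mu> (A i))"
proof (induction I rule: finite_induct)
  case (insert i I)
  then show ?case
    using mu_Un[of "A i" "\<Union>i\<in>I. A i"] by (auto intro: order_trans add_left_mono)
qed simp

lemma null_UN: "(\<And>i::nat. \<mu> (Z i) = 0) \<Longrightarrow> \<mu> (\<Union>i. Z i) = 0"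
  using mu_UN[of Z] by simp

lemma null_UN_countable:
  assumes "countable I" "\<And>i. i \<in> I \<Longrightarrow> \<mu> (Z i) = 0"
  shows "\<mu> (\<Union>i\<in>I. Z i) = 0"
proof (cases "I = {}")
  case False
  then have "(\<Union>i\<in>I. Z i) = (\<Union>n. Z (from_nat_into I n))"
    using assms(1) by (metis UN_extend_simps(10) range_from_nat_into)
  then show ?thesis using null_UN assms(2) False by (simp add: from_nat_into)
qed simp

lemma null_subset: "\<mu> B = 0 \<Longrightarrow> A \<subseteq> B \<Longrightarrow> \<mu> A = 0"
  using mu_mono[of A B] by simp

lemma null_Un: "\<mu> A = 0 \<Longrightarrow> \<mu> B = 0 \<Longrightarrow> \<mu> (A \<union> B) = 0"
  using mu_Un[of A B] by simp

text \<open>The splitting criterion is membership in the \<open>lambda_system\<close> of the full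
  power set, so Caratheodory's theorem makes \<open>\<mu>\<close> countably additive on these
  sets.\<close>

lemma caratheodory: "measure_space UNIV {B. mu_measurable \<mu> B} \<mu>"
proof -
  have eq: "{B. mu_measurable \<mu> B} = lambda_system UNIV UNIV \<mu>"
    unfolding lambda_system_def mu_measurable_def
    by (auto simp: Int_commute Diff_eq)
  have "outer_measure_space UNIV \<mu>"
    unfolding outer_measure_space_def positive_def increasing_def countably_subadditive_def
    using mu_mono mu_UN by auto
  then show ?thesis
    unfolding eq using sigma_algebra.caratheodory_lemma[OF sigma_algebra_Pow[of UNIV], simplified] by auto
qed

sublocale measurable: sigma_algebra UNIV "{B. mu_measurable \<mu> B}"
  using caratheodory by (simp add: measure_space_def)

lemma borel_measurable: "B \<in> sets borel \<Longrightarrow> mu_measurable \<mu> B"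
  using outer by (simp add: borel_regular_outer_measure_def)

lemma mu_split: "mu_measurable \<mu> B \<Longrightarrow> \<mu> E = \<mu> (E \<inter> B) + \<mu> (E - B)"
  by (simp add: mu_measurable_def)

lemma null_measurable: "\<mu> N = 0 \<Longrightarrow> mu_measurable \<mu> N"
  unfolding mu_measurable_def
proof
  fix E assume "\<mu> N = 0"
  then have "\<mu> (E \<inter> N) = 0" using null_subset by blast
  moreover have "\<mu> E \<le> \<mu> (E \<inter> N) + \<mu> (E - N)"
    using mu_Un[of "E \<inter> N" "E - N"] by (simp add: Int_Diff_Un)
  ultimately show "\<mu> (E \<inter> N) + \<mu> (E - N) = \<mu> E"
    using mu_mono[of "E - N" E] by (simp add: antisym)
qed

lemma measurable_Int: "mu_measurable \<mu> A \<Longrightarrow> mu_measurable \<mu> B \<Longrightarrow> mu_measurable \<mu> (A \<inter> B)"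
  using measurable.Int by simp

lemma measurable_diff_null: "mu_measurable \<mu> A \<Longrightarrow> \<mu> N = 0 \<Longrightarrow> mu_measurable \<mu> (A - N)"
  using measurable.Diff null_measurable by simp

text \<open>Packages the outer measure, restricted to Borel sets, as a \<open>measure\<close>, so
  that finite additivity, continuity from below and outer regularity become available.\<close>

definition borel_mu :: "'a measure" where
  "borel_mu = measure_of UNIV (sets borel) \<mu>"

lemma sets_borel_mu: "sets borel_mu = sets borel"
  using sets.sigma_sets_eq[of "borel :: 'a measure"] by (simp add: borel_mu_def)

lemma emeasure_borel_mu: "B \<in> sets borel \<Longrightarrow> emeasure borel_mu B = \<mu> B"
  unfolding borel_mu_def
proof (rule emeasure_measure_of_sigma)
  show "sigma_algebra UNIV (sets (borel :: 'a measure))"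
    using sets.sigma_algebra_axioms[of "borel :: 'a measure"] by simp
  show "countably_additive (sets borel) \<mu>"
    using caratheodory borel_measurable
    unfolding measure_space_def countably_additive_def by (simp add: subset_iff)
qed (auto simp: positive_def)

text \<open>One hull serves all measurable T at once. Splitting W and S along T gives equal totals,
  and the part of S outside T is at most that of W; finiteness allows this part to be cancelled. It
  replaces a possibly non-measurable S by a Borel set of the same local size.\<close>

lemma borel_hull:
  assumes "\<mu> S < top"
  obtains W where "W \<in> sets borel" "S \<subseteq> W" "\<mu> W = \<mu> S"
    "\<And>T. mu_measurable \<mu> T \<Longrightarrow> \<mu> (W \<inter> T) = \<mu> (S \<inter> T)"
proof -
  have "\<exists>W\<in>sets borel. S \<subseteq> W \<and> \<mu> W = \<mu> S"
    using outer by (simp add: borel_regular_outer_measure_def)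
  then obtain W where W: "W \<in> sets borel" "S \<subseteq> W" "\<mu> W = \<mu> S"
    by blast
  have "\<mu> (W \<inter> T) = \<mu> (S \<inter> T)" if T: "mu_measurable \<mu> T" for T
  proof (rule antisym)
    have "\<mu> (W - T) + \<mu> (W \<inter> T) = \<mu> (S - T) + \<mu> (S \<inter> T)"
      using mu_split[OF T, of W] mu_split[OF T, of S] W(3) by (simp add: add.commute)
    also have "\<dots> \<le> \<mu> (W - T) + \<mu> (S \<inter> T)"
      using W(2) by (intro add_right_mono mu_mono) blast
    finally show "\<mu> (W \<inter> T) \<le> \<mu> (S \<inter> T)"
      using mu_mono[of "W - T" W] W(3) assms
      by (auto simp: ennreal_add_left_cancel_le top_unique)
    show "\<mu> (S \<inter> T) \<le> \<mu> (W \<inter> T)"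
      using W(2) by (intro mu_mono) blast
  qed
  with W show ?thesis using that by blast
qed

text \<open>The product form stays in \<open>ennreal\<close> and avoids quotients. The set E may be
  non-measurable, and x need not belong to it.\<close>

definition density_point :: "'a set \<Rightarrow> 'a \<Rightarrow> bool" where
  "density_point E x \<longleftrightarrow> (\<forall>\<epsilon>>0. \<forall>\<^sub>F r in at_right 0. \<mu> (ball x r - E) \<le> ennreal \<epsilon> * \<mu> (ball x r))"

text \<open>Balls have positive finite measure, so neither \<open>enn2real\<close> nor the real
  division falls back on a default value.\<close>

lemma ratio_le_iff:
  assumes "r > 0" "\<epsilon> \<ge> 0"
  shows "enn2real (\<mu> (ball x r - E)) / enn2real (\<mu> (ball x r)) \<le> \<epsilon> \<longleftrightarrow>
    \<mu> (ball x r - E) \<le> ennreal \<epsilon> * \<mu> (ball x r)"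
proof -
  obtain b where b: "b > 0" "\<mu> (ball x r) = ennreal b"
    using ball_pos[OF assms(1), of x] ball_finite[OF assms(1), of x]
    by (metis ennreal_less_zero_iff less_top_ennreal)
  obtain a where a: "a \<ge> 0" "\<mu> (ball x r - E) = ennreal a"
    using ball_finite[OF assms(1), of x] mu_mono[of "ball x r - E" "ball x r"]
    by (metis Diff_subset le_less_trans less_top_ennreal)
  show ?thesis
    using a b assms(2) by (simp add: divide_le_eq flip: ennreal_mult)
qed

lemma density_point_iff_tendsto:
  "density_point E x \<longleftrightarrow>
    ((\<lambda>r. enn2real (\<mu> (ball x r - E)) / enn2real (\<mu> (ball x r))) \<longlongrightarrow> 0) (at_right 0)"
proof
  let ?q = "\<lambda>r. enn2real (\<mu> (ball x r - E)) / enn2real (\<mu> (ball x r))"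
  have pos: "\<forall>\<^sub>F r::real in at_right 0. r > 0" by (simp add: eventually_at_right_less)
  have nn: "?q r \<ge> 0" for r by simp
  show "(?q \<longlongrightarrow> 0) (at_right 0)" if "density_point E x"
  proof (rule tendstoI)
    fix e :: real assume "e > 0"
    then have "\<forall>\<^sub>F r in at_right 0. \<mu> (ball x r - E) \<le> ennreal (e/2) * \<mu> (ball x r)"
      using that by (simp add: density_point_def)
    with pos show "\<forall>\<^sub>F r in at_right 0. dist (?q r) 0 < e"
    proof eventually_elim
      case (elim r)
      then have "?q r \<le> e/2" using ratio_le_iff[of r "e/2" x E] \<open>e > 0\<close> by simp
      then show ?case using nn[of r] \<open>e > 0\<close> by (simp only: dist_real_def)
    qed
  qed
  show "density_point E x" if lim: "(?q \<longlongrightarrow> 0) (at_right 0)"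
    unfolding density_point_def
  proof (intro allI impI)
    fix e :: real assume "e > 0"
    then have "\<forall>\<^sub>F r in at_right 0. ?q r < e"
      using order_tendstoD(2)[OF lim] by simp
    with pos show "\<forall>\<^sub>F r in at_right 0. \<mu> (ball x r - E) \<le> ennreal e * \<mu> (ball x r)"
    proof eventually_elim
      case (elim r)
      then have "?q r \<le> e" by simp
      then show ?case using elim(1) \<open>e > 0\<close> ratio_le_iff by simp
    qed
  qed
qed

lemma density_point_transfer:
  assumes "density_point E x" and le: "\<And>r. \<mu> (ball x r - F) \<le> \<mu> (ball x r - E)"
  shows "density_point F x"
  unfolding density_point_def
proof (intro allI impI)
  fix e :: real assume "e > 0"
  then have "\<forall>\<^sub>F r in at_right 0. \<mu> (ball x r - E) \<le> ennreal e * \<mu> (ball x r)"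
    using assms(1) by (simp add: density_point_def)
  then show "\<forall>\<^sub>F r in at_right 0. \<mu> (ball x r - F) \<le> ennreal e * \<mu> (ball x r)"
    by eventually_elim (rule order_trans[OF le])
qed

lemma density_point_mono: "density_point E x \<Longrightarrow> E \<subseteq> F \<Longrightarrow> density_point F x"
  by (erule density_point_transfer) (auto intro: mu_mono)

lemma density_point_modulo_null:
  assumes "density_point E x" "\<mu> (E - F) = 0"
  shows "density_point F x"
proof (rule density_point_transfer[OF assms(1)])
  show "\<mu> (ball x r - F) \<le> \<mu> (ball x r - E)" for r
    using mu_mono[of "ball x r - F" "(ball x r - E) \<union> (E - F)"]
      mu_Un[of "ball x r - E" "E - F"] assms(2) by (auto intro: order_trans)
qed

lemma density_point_Int:
  assumes "density_point E x" "density_point F x"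
  shows "density_point (E \<inter> F) x"
  unfolding density_point_def
proof (intro allI impI)
  fix e :: real assume "e > 0"
  then have "\<forall>\<^sub>F r in at_right 0. \<mu> (ball x r - E) \<le> ennreal (e/2) * \<mu> (ball x r)"
    "\<forall>\<^sub>F r in at_right 0. \<mu> (ball x r - F) \<le> ennreal (e/2) * \<mu> (ball x r)"
    using assms by (simp_all add: density_point_def)
  then show "\<forall>\<^sub>F r in at_right 0. \<mu> (ball x r - E \<inter> F) \<le> ennreal e * \<mu> (ball x r)"
  proof eventually_elim
    case (elim r)
    have "\<mu> (ball x r - E \<inter> F) \<le> \<mu> (ball x r - E) + \<mu> (ball x r - F)"
      using mu_Un[of "ball x r - E" "ball x r - F"] by (simp add: Diff_Int)
    also have "\<dots> \<le> (ennreal (e/2) + ennreal (e/2)) * \<mu> (ball x r)"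
      using elim by (simp add: distrib_right add_mono)
    also have "ennreal (e/2) + ennreal (e/2) = ennreal e"
      using \<open>e > 0\<close> by (simp flip: ennreal_plus)
    finally show ?case .
  qed
qed

text \<open>Passing to a Borel hull of the complement in a unit ball makes the Borel core in
  the definition of a \<open>\<mu>\<close>-neighbourhood superfluous.\<close>

lemma mu_nbhd_iff: "mu_nbhd \<mu> x E \<longleftrightarrow> x \<in> E \<and> density_point E x"
proof
  show "x \<in> E \<and> density_point E x" if "mu_nbhd \<mu> x E"
    using that density_point_mono unfolding mu_nbhd_def density_point_iff_tendsto[symmetric] by blast
next
  assume E: "x \<in> E \<and> density_point E x"
  have "\<mu> (ball x 1 - E) < top"
    using mu_mono[of "ball x 1 - E" "ball x 1"] ball_finite[of 1 x] by (auto intro: le_less_trans)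
  then obtain W where W: "W \<in> sets borel" "ball x 1 - E \<subseteq> W"
    "\<And>T. mu_measurable \<mu> T \<Longrightarrow> \<mu> (W \<inter> T) = \<mu> ((ball x 1 - E) \<inter> T)"
    using borel_hull by metis
  have "\<forall>\<^sub>F r in at_right 0. r \<in> {0<..<1::real}"
    by (rule eventually_at_right_real) simp
  \<comment> \<open>For r < 1 the ball lies inside the unit ball, where the hull property with T =
    \<open>ball x r\<close> shows that replacing E by the Borel core \<open>ball x 1 - W\<close>
    does not change the measure of what is left over.\<close>
  then have "\<forall>\<^sub>F r in at_right 0. \<mu> (ball x r - (ball x 1 - W)) = \<mu> (ball x r - E)"
  proof eventually_elim
    case (elim r)
    then have "ball x r - (ball x 1 - W) = W \<inter> ball x r" "ball x r - E = (ball x 1 - E) \<inter> ball x r"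
      by auto
    then show ?case using W(3)[of "ball x r"] borel_measurable by simp
  qed
  then have "density_point (ball x 1 - W) x"
    using E unfolding density_point_def by (auto elim: eventually_elim2)
  then show "mu_nbhd \<mu> x E"
    unfolding mu_nbhd_def density_point_iff_tendsto[symmetric]
    using E W(1,2) by (intro conjI bexI[of _ "ball x 1 - W"]) auto
qed

subsection \<open>The Lebesgue density theorem\<close>

text \<open>Enlarge the radius from 3r to 4r and double twice; this is the source of the factor
  \<open>K\<^sup>2\<close> below.\<close>

lemma ball_triple:
  assumes "r > 0"
  shows "\<mu> (ball x (3 * r)) \<le> ennreal (K\<^sup>2) * \<mu> (ball x r)"
proof -
  have "\<mu> (ball x (3 * r)) \<le> \<mu> (ball x (2 * (2 * r)))"
    using assms by (intro mu_mono subset_ball) simp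
  also have "\<dots> \<le> ennreal K * \<mu> (ball x (2 * r))"
    using assms by (intro ball_double) simp
  also have "\<dots> \<le> ennreal K * (ennreal K * \<mu> (ball x r))"
    using assms by (intro mult_left_mono ball_double) simp_all
  also have "\<dots> = ennreal (K\<^sup>2) * \<mu> (ball x r)"
    using K_pos by (simp add: power2_eq_square ennreal_mult mult.assoc)
  finally show ?thesis .
qed

lemma mu_sum_disjoint:
  assumes "finite J" "disjoint_family_on A J" "\<And>j. j \<in> J \<Longrightarrow> A j \<in> sets borel"
  shows "(\<Sum>j\<in>J. \<mu> (A j)) = \<mu> (\<Union>j\<in>J. A j)"
proof -
  have "(\<Sum>j\<in>J. emeasure borel_mu (A j)) = emeasure borel_mu (\<Union>j\<in>J. A j)"
    using assms by (intro sum_emeasure) (auto simp: sets_borel_mu)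
  moreover have "(\<Union>j\<in>J. A j) \<in> sets borel"
    using assms by blast
  ultimately show ?thesis
    using assms(3) by (simp add: emeasure_borel_mu)
qed

lemma vitali_bound_finite:
  assumes H: "H \<in> sets borel" and "finite I"
    and r: "\<And>x. x \<in> I \<Longrightarrow> r x > 0 \<and> ball x (r x) \<subseteq> U \<and>
      ennreal t * \<mu> (ball x (r x)) \<le> \<mu> (ball x (r x) - H)"
  shows "ennreal t * \<mu> (\<Union>x\<in>I. ball x (r x)) \<le> ennreal (K\<^sup>2) * \<mu> (U - H)"
proof -
  obtain J where J: "J \<subseteq> I" "disjoint_family_on (\<lambda>x. ball x (r x)) J"
    "(\<Union>x\<in>I. ball x (r x)) \<subseteq> (\<Union>x\<in>J. ball x (3 * r x))"
    using finite_ball_subcover[OF \<open>finite I\<close>] by blast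
  have "finite J" using J(1) \<open>finite I\<close> finite_subset by blast
  have rJ: "r x > 0" "ball x (r x) \<subseteq> U"
      "ennreal t * \<mu> (ball x (r x)) \<le> \<mu> (ball x (r x) - H)" if "x \<in> J" for x
    using r J(1) that by auto
  have "\<mu> (\<Union>x\<in>I. ball x (r x)) \<le> (\<Sum>x\<in>J. \<mu> (ball x (3 * r x)))"
    using mu_mono[OF J(3)] mu_UN_finite[OF \<open>finite J\<close>] by (rule order_trans)
  also have "\<dots> \<le> (\<Sum>x\<in>J. ennreal (K\<^sup>2) * \<mu> (ball x (r x)))"
    using rJ(1) by (intro sum_mono ball_triple) auto
  also have "\<dots> = ennreal (K\<^sup>2) * (\<Sum>x\<in>J. \<mu> (ball x (r x)))"
    by (simp add: sum_distrib_left)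
  finally have "ennreal t * \<mu> (\<Union>x\<in>I. ball x (r x))
      \<le> ennreal t * (ennreal (K\<^sup>2) * (\<Sum>x\<in>J. \<mu> (ball x (r x))))"
    by (rule mult_left_mono) simp
  also have "\<dots> = ennreal (K\<^sup>2) * (\<Sum>x\<in>J. ennreal t * \<mu> (ball x (r x)))"
    by (simp add: sum_distrib_left mult.left_commute)
  also have "\<dots> \<le> ennreal (K\<^sup>2) * (\<Sum>x\<in>J. \<mu> (ball x (r x) - H))"
    using rJ(3) by (intro mult_left_mono sum_mono) auto
  also have "(\<Sum>x\<in>J. \<mu> (ball x (r x) - H)) = \<mu> (\<Union>x\<in>J. ball x (r x) - H)"
  proof (rule mu_sum_disjoint[OF \<open>finite J\<close>])
    show "disjoint_family_on (\<lambda>x. ball x (r x) - H) J"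
      using J(2) by (auto simp: disjoint_family_on_def)
  qed (use H in auto)
  also have "\<dots> \<le> \<mu> (U - H)"
    using rJ(2) by (intro mu_mono) blast
  finally show ?thesis by (simp add: mult_left_mono)
qed

text \<open>By Lindelof countably many of the balls cover Z; the finite estimate holds for each
  initial union and passes to the limit by continuity from below. Only this open cover of Z is
  measured, so Z can be an arbitrary set.\<close>

lemma vitali_bound:
  assumes H: "H \<in> sets borel"
    and Z: "\<And>x. x \<in> Z \<Longrightarrow> \<exists>r>0. ball x r \<subseteq> U \<and> ennreal t * \<mu> (ball x r) \<le> \<mu> (ball x r - H)"
  shows "ennreal t * \<mu> Z \<le> ennreal (K\<^sup>2) * \<mu> (U - H)"
proof (cases "Z = {}")
  case False
  obtain r where r: "\<And>x. x \<in> Z \<Longrightarrow> r x > 0 \<and> ball x (r x) \<subseteq> U \<and>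
      ennreal t * \<mu> (ball x (r x)) \<le> \<mu> (ball x (r x) - H)"
    using Z by metis
  obtain F where F: "F \<subseteq> (\<lambda>x. ball x (r x)) ` Z" "countable F"
      "\<Union>F = (\<Union>x\<in>Z. ball x (r x))"
    using Lindelof[of "(\<lambda>x. ball x (r x)) ` Z"] by (metis (no_types, lifting) imageE open_ball)
  obtain Z' where Z': "countable Z'" "Z' \<subseteq> Z" "F = (\<lambda>x. ball x (r x)) ` Z'"
    using F(1,2) countable_subset_image[of F "\<lambda>x. ball x (r x)" Z] by auto
  have cover: "Z \<subseteq> (\<Union>x\<in>Z'. ball x (r x))"
    using F(3) Z'(3) r by fastforce
  then have "Z' \<noteq> {}" using False by auto
  define e where "e = from_nat_into Z'"
  have e: "range e = Z'"
    unfolding e_def using Z'(1) \<open>Z' \<noteq> {}\<close> by (rule range_from_nat_into[rotated])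
  define A where "A n = (\<Union>x\<in>e ` {..<n}. ball x (r x))" for n
  have A_borel: "A n \<in> sets borel" for n
    unfolding A_def by (intro borel_open open_UN) auto
  have "incseq A"
    unfolding A_def by (intro monoI UN_mono image_mono) auto
  have "Z \<subseteq> (\<Union>n. A n)"
  proof
    fix z assume "z \<in> Z"
    then obtain x where "x \<in> Z'" "z \<in> ball x (r x)" using cover by blast
    then obtain n where "e n = x" using e by blast
    then have "z \<in> A (Suc n)" using \<open>z \<in> ball x (r x)\<close> by (auto simp: A_def)
    then show "z \<in> (\<Union>n. A n)" by blast
  qed
  then have "\<mu> Z \<le> \<mu> (\<Union>n. A n)" by (rule mu_mono)
  also have "\<dots> = (SUP n. \<mu> (A n))"
    using SUP_emeasure_incseq[of A borel_mu] A_borel \<open>incseq A\<close>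
    by (simp add: image_subset_iff sets_borel_mu emeasure_borel_mu)
  finally have "ennreal t * \<mu> Z \<le> ennreal t * (SUP n. \<mu> (A n))"
    by (rule mult_left_mono) simp
  also have "\<dots> = (SUP n. ennreal t * \<mu> (A n))"
    by (simp add: SUP_mult_left_ennreal)
  also have "\<dots> \<le> ennreal (K\<^sup>2) * \<mu> (U - H)"
  proof (rule SUP_least)
    fix n
    have "e ` {..<n} \<subseteq> Z" using e Z'(2) by blast
    then show "ennreal t * \<mu> (A n) \<le> ennreal (K\<^sup>2) * \<mu> (U - H)"
      unfolding A_def using r by (intro vitali_bound_finite[OF H]) auto
  qed
  finally show ?thesis .
qed simp

text \<open>Outer regularity of finite Borel measures on a Polish space applies once
  \<open>borel_mu\<close> is weighted with the indicator of the ball. The trace of H on the ball has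
  finite measure, which makes adding e a strict increase and lets the common term be cancelled at
  the end.\<close>

lemma outer_regular_in_ball:
  assumes "H \<in> sets borel" "R > 0" "e > 0"
  obtains U where "open U" "H \<inter> ball a R \<subseteq> U" "U \<subseteq> ball a R" "\<mu> (U - H) \<le> ennreal e"
proof -
  let ?b = "ball a R"
  let ?M = "density borel_mu (indicator ?b)"
  have b: "?b \<in> sets borel" by simp
  have M: "emeasure ?M B = \<mu> (?b \<inter> B)" if "B \<in> sets borel" for B
    using emeasure_restricted[of ?b borel_mu B] that b emeasure_borel_mu[of "?b \<inter> B"]
    by (simp add: sets_borel_mu)
  have setsM: "sets ?M = sets borel" by (simp add: sets_borel_mu)
  have "space ?M = UNIV" using sets_eq_imp_space_eq[OF setsM] by simp
  then have "emeasure ?M (space ?M) \<noteq> \<infinity>"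
    using M[of UNIV] ball_finite[OF \<open>R > 0\<close>, of a] by simp
  from outer_regular[OF setsM this \<open>H \<in> sets borel\<close>]
  have inf: "\<mu> (?b \<inter> H) = (INF V\<in>{V. H \<subseteq> V \<and> open V}. emeasure ?M V)"
    using M[OF \<open>H \<in> sets borel\<close>] by simp
  have fin: "\<mu> (?b \<inter> H) < top"
    using mu_mono[of "?b \<inter> H" ?b] ball_finite[OF \<open>R > 0\<close>, of a] by (auto intro: le_less_trans)
  then have "\<mu> (?b \<inter> H) < \<mu> (?b \<inter> H) + ennreal e"
    using \<open>e > 0\<close> by (metis add.right_neutral ennreal_add_left_cancel_less ennreal_less_zero_iff
        infinity_ennreal_def order_less_irrefl)
  then obtain V where V: "H \<subseteq> V" "open V" "emeasure ?M V < \<mu> (?b \<inter> H) + ennreal e"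
    unfolding inf INF_less_iff by blast
  have "\<mu> (?b \<inter> V) = \<mu> (?b \<inter> H) + \<mu> (?b \<inter> V - H)"
    using mu_split[OF borel_measurable[OF \<open>H \<in> sets borel\<close>], of "?b \<inter> V"] V(1)
    by (simp add: Int_assoc inf.absorb2)
  with V have "\<mu> (?b \<inter> H) + \<mu> (?b \<inter> V - H) < \<mu> (?b \<inter> H) + ennreal e"
    using M[of V] by simp
  then have "\<mu> (?b \<inter> V - H) \<le> ennreal e"
    by (simp add: ennreal_add_left_cancel_less less_imp_le)
  then show ?thesis
    using V by (intro that[of "?b \<inter> V"]) auto
qed

text \<open>Enclose the set in an open U with little mass outside H. At a bad point the density
  condition fails for arbitrarily small radii, hence for a ball inside U, so
  \<open>vitali_bound\<close> makes the outer measure of the bad set as small as desired.\<close>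

lemma null_not_density_point_in_ball:
  assumes H: "H \<in> sets borel" and "R > 0" "t > 0"
  shows "\<mu> {x \<in> H \<inter> ball a R. \<not> (\<forall>\<^sub>F r in at_right 0. \<mu> (ball x r - H) \<le> ennreal t * \<mu> (ball x r))} = 0"
    (is "\<mu> ?Z = 0")
proof -
  have "ennreal t * \<mu> ?Z \<le> 0 + ennreal e" if "e > 0" for e
  proof -
    \<comment> \<open>Chosen to absorb the factor \<open>K\<^sup>2\<close> of
      \<open>vitali_bound\<close>.\<close>
    define \<delta> where "\<delta> = e / K\<^sup>2"
    have "\<delta> > 0" using that K_pos by (simp add: \<delta>_def)
    then obtain U where U: "open U" "H \<inter> ball a R \<subseteq> U" "\<mu> (U - H) \<le> ennreal \<delta>"
      using outer_regular_in_ball[OF H \<open>R > 0\<close>] by metis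
    have "\<exists>r>0. ball x r \<subseteq> U \<and> ennreal t * \<mu> (ball x r) \<le> \<mu> (ball x r - H)" if x: "x \<in> ?Z" for x
    proof -
      obtain s where s: "s > 0" "ball x s \<subseteq> U"
        using x U(1,2) open_contains_ball by blast
      have "\<not> (\<forall>\<^sub>F r in at_right 0. \<mu> (ball x r - H) \<le> ennreal t * \<mu> (ball x r))"
        using x by blast
      then have "\<exists>r. 0 < r \<and> r < s \<and> \<not> \<mu> (ball x r - H) \<le> ennreal t * \<mu> (ball x r)"
        using \<open>s > 0\<close> unfolding eventually_at_right_field by blast
      then obtain r where r: "0 < r" "r < s" "\<not> \<mu> (ball x r - H) \<le> ennreal t * \<mu> (ball x r)"
        by blast
      then show ?thesis
        using s subset_ball[of r s x] by (intro exI[of _ r]) auto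
    qed
    then have "ennreal t * \<mu> ?Z \<le> ennreal (K\<^sup>2) * \<mu> (U - H)"
      by (rule vitali_bound[OF H])
    also have "\<dots> \<le> ennreal (K\<^sup>2) * ennreal \<delta>"
      using U(3) by (rule mult_left_mono) simp
    also have "\<dots> = ennreal e"
      using K_pos that by (simp add: \<delta>_def flip: ennreal_mult)
    finally show ?thesis by simp
  qed
  then have "ennreal t * \<mu> ?Z \<le> 0"
    by (rule ennreal_le_epsilon)
  then show ?thesis using \<open>t > 0\<close> by simp
qed

lemma null_not_density_point_borel:
  assumes "H \<in> sets borel"
  shows "\<mu> {x \<in> H. \<not> density_point H x} = 0"
proof -
  \<comment> \<open>An arbitrary centre, whose balls of radius m + 1 exhaust the space. The
    tolerances 1 / (n + 1) suffice because the density condition weakens as the tolerance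
    grows.\<close>
  fix a :: 'a
  define Z where "Z m n = {x \<in> H \<inter> ball a (real (Suc m)).
      \<not> (\<forall>\<^sub>F r in at_right 0. \<mu> (ball x r - H) \<le> ennreal (inverse (real (Suc n))) * \<mu> (ball x r))}" for m n
  have "\<mu> (\<Union>m. \<Union>n. Z m n) = 0"
    unfolding Z_def by (intro null_UN null_not_density_point_in_ball assms) simp_all
  moreover have "{x \<in> H. \<not> density_point H x} \<subseteq> (\<Union>m. \<Union>n. Z m n)"
  proof
    fix x assume "x \<in> {x \<in> H. \<not> density_point H x}"
    then obtain e where x: "x \<in> H" "e > 0"
      "\<not> (\<forall>\<^sub>F r in at_right 0. \<mu> (ball x r - H) \<le> ennreal e * \<mu> (ball x r))"
      unfolding density_point_def by blast
    obtain m where m: "dist a x < real (Suc m)"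
      using reals_Archimedean2[of "dist a x"] by (metis less_Suc_eq of_nat_less_iff order_less_trans)
    obtain n where n: "inverse (real (Suc n)) < e" using reals_Archimedean[OF x(2)] by blast
    have le: "ennreal (inverse (real (Suc n))) * b \<le> ennreal e * b" for b
      using n by (intro mult_right_mono ennreal_leI) simp_all
    have "\<not> (\<forall>\<^sub>F r in at_right 0. \<mu> (ball x r - H) \<le> ennreal (inverse (real (Suc n))) * \<mu> (ball x r))"
    proof
      assume "\<forall>\<^sub>F r in at_right 0. \<mu> (ball x r - H) \<le> ennreal (inverse (real (Suc n))) * \<mu> (ball x r)"
      then have "\<forall>\<^sub>F r in at_right 0. \<mu> (ball x r - H) \<le> ennreal e * \<mu> (ball x r)"
        by eventually_elim (erule order_trans[OF _ le])
      with x(3) show False ..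
    qed
    then have "x \<in> Z m n" using x(1) m by (simp add: Z_def)
    then show "x \<in> (\<Union>m. \<Union>n. Z m n)" by blast
  qed
  ultimately show ?thesis by (rule null_subset)
qed

text \<open>Reduction to Borel sets: inside a ball, removing a Borel hull W of the complement of B
  leaves a Borel subset of B. What is lost from B is \<open>W \<inter> B\<close>, which is null by
  the hull property with T = B.\<close>

theorem lebesgue_density:
  assumes B: "mu_measurable \<mu> B"
  shows "\<mu> {x \<in> B. \<not> density_point B x} = 0"
proof -
  fix a :: 'a
  have "\<mu> {x \<in> B \<inter> ball a (real (Suc n)). \<not> density_point B x} = 0" for n
  proof -
    let ?b = "ball a (real (Suc n))"
    have fin: "\<mu> ?b < top" by (rule ball_finite) simp
    then have "\<mu> (?b - B) < top"
      using mu_mono[of "?b - B" ?b] by (auto intro: le_less_trans)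
    then obtain W where W: "W \<in> sets borel" "?b - B \<subseteq> W"
        "\<And>T. mu_measurable \<mu> T \<Longrightarrow> \<mu> (W \<inter> T) = \<mu> ((?b - B) \<inter> T)"
      using borel_hull by metis
    let ?H = "?b - W"
    have "\<mu> (W \<inter> B) = \<mu> ((?b - B) \<inter> B)"
      using W(3) B by blast
    also have "(?b - B) \<inter> B = {}" by blast
    finally have "\<mu> (W \<inter> B) = 0" by simp
    moreover have "\<mu> {x \<in> ?H. \<not> density_point ?H x} = 0"
      using W(1) by (intro null_not_density_point_borel) auto
    ultimately have "\<mu> ((W \<inter> B) \<union> {x \<in> ?H. \<not> density_point ?H x}) = 0"
      by (rule null_Un)
    moreover have "density_point ?H x \<Longrightarrow> density_point B x" for x
      using W(2) by (elim density_point_mono) blast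
    then have "{x \<in> B \<inter> ?b. \<not> density_point B x} \<subseteq> (W \<inter> B) \<union> {x \<in> ?H. \<not> density_point ?H x}"
      by blast
    ultimately show ?thesis by (rule null_subset)
  qed
  then have "\<mu> (\<Union>n. {x \<in> B \<inter> ball a (real (Suc n)). \<not> density_point B x}) = 0"
    by (rule null_UN)
  moreover have "{x \<in> B. \<not> density_point B x} \<subseteq> (\<Union>n. {x \<in> B \<inter> ball a (real (Suc n)). \<not> density_point B x})"
  proof
    fix x assume "x \<in> {x \<in> B. \<not> density_point B x}"
    moreover obtain n where "dist a x < real (Suc n)"
      using reals_Archimedean2[of "dist a x"] by (metis less_Suc_eq of_nat_less_iff order_less_trans)
    ultimately show "x \<in> (\<Union>n. {x \<in> B \<inter> ball a (real (Suc n)). \<not> density_point B x})" by auto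
  qed
  ultimately show ?thesis by (rule null_subset)
qed

subsection \<open>Approximate differentiability\<close>

lemma mu_nbhd_Int: "mu_nbhd \<mu> x U \<Longrightarrow> mu_nbhd \<mu> x V \<Longrightarrow> mu_nbhd \<mu> x (U \<inter> V)"
  by (simp add: mu_nbhd_iff density_point_Int)

text \<open>Density alone does not give accumulation: at an isolated point x the set
  \<open>{x}\<close> is a neighbourhood. The accumulation hypothesis on A supplies a second point in
  \<open>U \<inter> C\<close>, which is again a neighbourhood.\<close>

lemma mu_acc_density_point:
  assumes "mu_acc \<mu> A x" "x \<in> C" "density_point C x"
  shows "mu_acc \<mu> C x"
  unfolding mu_acc_def
proof (intro allI impI)
  fix U assume "mu_nbhd \<mu> x U"
  then have "mu_nbhd \<mu> x (U \<inter> C)"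
    using assms(2,3) by (simp add: mu_nbhd_iff density_point_Int)
  then have "A \<inter> (U \<inter> C) - {x} \<noteq> {}"
    using assms(1) by (simp add: mu_acc_def)
  then show "C \<inter> U - {x} \<noteq> {}" by blast
qed

text \<open>This lemma and the next trade the finite limsup for a Lipschitz estimate at x on a
  single neighbourhood, multiplied out so that y = x needs no exception.\<close>

lemma A_f_mu_I:
  assumes "x \<in> A" "mu_acc \<mu> A x" "mu_nbhd \<mu> x U"
    and lip: "\<And>y. y \<in> U \<inter> A \<Longrightarrow> dist (f y) (f x) \<le> L * dist y x"
  shows "x \<in> A_f_mu \<mu> A f"
proof -
  let ?q = "\<lambda>y. dist (f y) (f x) / dist y x"
  have "mu_limsup \<mu> A ?q x \<le> (SUP y\<in>U \<inter> A - {x}. ereal (?q y))"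
    unfolding mu_limsup_def using assms(3) by (intro INF_lower) simp
  also have "\<dots> \<le> ereal L"
    using lip by (intro SUP_least) (simp add: divide_le_eq)
  also have "\<dots> < \<infinity>" by simp
  finally show ?thesis using assms(1,2) by (simp add: A_f_mu_def)
qed

lemma A_f_mu_D:
  assumes "x \<in> A_f_mu \<mu> A f"
  obtains U L where "L \<ge> 0" "mu_nbhd \<mu> x U"
    "\<And>y. y \<in> U \<inter> A \<Longrightarrow> dist (f y) (f x) \<le> L * dist y x"
proof -
  let ?q = "\<lambda>y. dist (f y) (f x) / dist y x"
  have "mu_limsup \<mu> A ?q x < \<infinity>" using assms by (simp add: A_f_mu_def)
  then obtain U where U: "mu_nbhd \<mu> x U" "(SUP y\<in>U \<inter> A - {x}. ereal (?q y)) < \<infinity>"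
    unfolding mu_limsup_def INF_less_iff by blast
  then obtain n :: nat where n: "(SUP y\<in>U \<inter> A - {x}. ereal (?q y)) < ereal (real n)"
    by (auto simp: less_PInf_Ex_of_nat)
  have "dist (f y) (f x) \<le> real n * dist y x" if "y \<in> U \<inter> A" for y
  proof (cases "y = x")
    case False
    then have "ereal (?q y) \<le> (SUP y\<in>U \<inter> A - {x}. ereal (?q y))"
      using that by (intro SUP_upper) simp
    also note n
    finally have "?q y \<le> real n" by simp
    then show ?thesis using False by (simp add: pos_divide_le_eq)
  qed simp
  with U(1) show ?thesis using that[of "real n" U] by simp
qed

text \<open>The limit sees the maps only near x in the sense of neighbourhoods, so the germ found
  for g serves f as well, on the smaller neighbourhood \<open>U \<inter> V\<close>. Agreement at x
  itself keeps the germ in the fibre of D over \<open>(x, f x)\<close>.\<close>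

lemma approx_D_diff_at_transfer:
  assumes diff: "approx_D_diff_at \<mu> D C g x"
    and "x \<in> A" "mu_acc \<mu> A x" "mu_nbhd \<mu> x U"
    and eq: "\<And>y. y \<in> U \<inter> A \<Longrightarrow> y \<in> C \<and> g y = f y"
  shows "approx_D_diff_at \<mu> D A f x"
proof -
  obtain c W F where c: "(x, g x, c) \<in> D" "(W, F) \<in> c"
    and lim: "mu_lim \<mu> (C \<inter> W) (\<lambda>y. dist (g y) (F y) / dist y x) x 0"
    using diff unfolding approx_D_diff_at_def by blast
  have "x \<in> U" using assms(4) by (simp add: mu_nbhd_def)
  then have "g x = f x" using eq \<open>x \<in> A\<close> by blast
  have "mu_lim \<mu> (A \<inter> W) (\<lambda>y. dist (f y) (F y) / dist y x) x 0"
    unfolding mu_lim_def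
  proof (intro allI impI)
    fix e :: real assume "e > 0"
    then obtain V where V: "mu_nbhd \<mu> x V"
      "\<And>y. y \<in> (C \<inter> W) \<inter> V - {x} \<Longrightarrow> \<bar>dist (g y) (F y) / dist y x - 0\<bar> < e"
      using lim unfolding mu_lim_def by blast
    have "\<bar>dist (f y) (F y) / dist y x - 0\<bar> < e" if "y \<in> (A \<inter> W) \<inter> (U \<inter> V) - {x}" for y
      using V(2)[of y] eq[of y] that by auto
    then show "\<exists>V. mu_nbhd \<mu> x V \<and> (\<forall>y\<in>(A \<inter> W) \<inter> V - {x}. \<bar>dist (f y) (F y) / dist y x - 0\<bar> < e)"
      using mu_nbhd_Int[OF assms(4) V(1)] by blast
  qed
  then show ?thesis
    unfolding approx_D_diff_at_def using c \<open>g x = f x\<close> assms(2,3) by auto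
qed

section \<open>Decomposition of the finite-slope set into Lipschitz pieces\<close>

text \<open>The constant \<open>1 / (2 * (1 + K\<^sup>2))\<close> is chosen so that for two points \<open>x\<close>, \<open>y\<close> of a
  piece at distance \<open>s\<close> the exceptional parts of \<open>ball x (2 * s)\<close> and \<open>ball y s\<close> do not
  cover \<open>ball y s\<close>.\<close>

definition piece :: "('a \<Rightarrow> 'b::metric_space) \<Rightarrow> 'a set \<Rightarrow> nat \<Rightarrow> 'a set" where
  "piece f B k = {x \<in> B. \<forall>r>0. r < 1 / real (Suc k) \<longrightarrow>
     \<mu> (ball x r - {z \<in> B. dist (f z) (f x) \<le> real (Suc k) * dist z x})
       \<le> ennreal (1 / (2 * (1 + K\<^sup>2))) * \<mu> (ball x r)}"

lemma piece_cover:
  assumes "x \<in> B" "B \<subseteq> A" "density_point B x" "x \<in> A_f_mu \<mu> A f"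
  shows "\<exists>k. x \<in> piece f B k"
proof -
  obtain U L where U: "L \<ge> 0" "mu_nbhd \<mu> x U"
    "\<And>y. y \<in> U \<inter> A \<Longrightarrow> dist (f y) (f x) \<le> L * dist y x"
    using A_f_mu_D[OF assms(4)] by blast
  define e where "e = 1 / (2 * (1 + K\<^sup>2))"
  have "e > 0" by (simp add: e_def add_pos_nonneg)
  have "density_point (U \<inter> B) x" using U(2) assms(3) by (simp add: mu_nbhd_iff density_point_Int)
  then have "\<forall>\<^sub>F r in at_right 0. \<mu> (ball x r - U \<inter> B) \<le> ennreal e * \<mu> (ball x r)"
    using \<open>e > 0\<close> by (simp add: density_point_def)
  then obtain b where b: "b > 0"
    "\<And>r. 0 < r \<Longrightarrow> r < b \<Longrightarrow> \<mu> (ball x r - U \<inter> B) \<le> ennreal e * \<mu> (ball x r)"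
    unfolding eventually_at_right_field by blast
  \<comment> \<open>One index controls both requirements of \<open>piece\<close>: it exceeds the
    slope bound L, and 1 / (k + 1) lies below the radius b up to which the density estimate
    holds.\<close>
  obtain k where k: "max L (1 / b) < real k"
    using reals_Archimedean2 by blast
  have "1 / real (Suc k) < b"
    using k b(1) by (simp add: field_simps)
  have "U \<inter> B \<subseteq> {z \<in> B. dist (f z) (f x) \<le> real (Suc k) * dist z x}"
  proof
    fix z assume z: "z \<in> U \<inter> B"
    then have "dist (f z) (f x) \<le> L * dist z x" using U(3) assms(2) by blast
    also have "\<dots> \<le> real (Suc k) * dist z x"
      using k by (intro mult_right_mono) auto
    finally show "z \<in> {z \<in> B. dist (f z) (f x) \<le> real (Suc k) * dist z x}" using z by blast
  qed
  then have "\<mu> (ball x r - {z \<in> B. dist (f z) (f x) \<le> real (Suc k) * dist z x})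
      \<le> \<mu> (ball x r - U \<inter> B)" for r
    by (intro mu_mono) blast
  then have "x \<in> piece f B k"
    unfolding piece_def e_def[symmetric]
    using assms(1) b(2) \<open>1 / real (Suc k) < b\<close> by (blast intro: order_trans less_trans)
  then show ?thesis ..
qed

lemma half_ball_less:
  assumes "r > 0"
  shows "ennreal (1/2) * \<mu> (ball x r) < \<mu> (ball x r)"
proof -
  have "ennreal (1/2) < 1" by (simp only: ennreal_less_one_iff)
  then have "ennreal (1/2) * \<mu> (ball x r) < 1 * \<mu> (ball x r)"
    using assms by (intro ennreal_mult_strict_right_mono ball_pos ball_finite)
  then show ?thesis by simp
qed

text \<open>Some z near y has controlled slope from x and from y, and f is compared through z. The
  constant 3 is 2 + 1, since z is within 2s of x and within s of y, where s is the distance of the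
  two points.\<close>

lemma piece_lipschitz:
  assumes x: "x \<in> piece f B k" and y: "y \<in> piece f B k"
    and near: "2 * dist x y < 1 / real (Suc k)"
  shows "dist (f x) (f y) \<le> 3 * real (Suc k) * dist x y"
proof (cases "x = y")
  case False
  define s where "s = dist x y"
  define e where "e = 1 / (2 * (1 + K\<^sup>2))"
  define G where "G x = {z \<in> B. dist (f z) (f x) \<le> real (Suc k) * dist z x}" for x
  have s: "s > 0" "2 * s < 1 / real (Suc k)"
    using False near by (simp_all add: s_def)
  then have "s < 1 / real (Suc k)" by linarith
  have "1 + K\<^sup>2 > 0" by (simp add: add_pos_nonneg)
  moreover have "e + e * K\<^sup>2 = e * (1 + K\<^sup>2)" by (simp add: distrib_left)
  ultimately have e: "e > 0" "e + e * K\<^sup>2 = 1 / 2"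
    by (simp_all add: e_def)
  have small: "\<mu> (ball x (2 * s) - G x) \<le> ennreal e * \<mu> (ball x (2 * s))"
    "\<mu> (ball y s - G y) \<le> ennreal e * \<mu> (ball y s)"
    using x y s \<open>s < 1 / real (Suc k)\<close> unfolding piece_def e_def G_def by simp_all
  \<comment> \<open>The first inclusion places the search for z inside both balls. The second, with
    \<open>ball_triple\<close>, bounds the exceptional part around x by \<open>e * K\<^sup>2\<close>
    times the measure of \<open>ball y s\<close>; together with the part around y this is half of
    that ball.\<close>
  have sub: "ball y s \<subseteq> ball x (2 * s)" "ball x (2 * s) \<subseteq> ball y (3 * s)"
  proof (safe, goal_cases)
    case (1 z)
    then show ?case using dist_triangle[of x z y] by (simp add: s_def)
  next
    case (2 z)
    then show ?case using dist_triangle[of y z x] by (simp add: s_def dist_commute)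
  qed
  have "\<exists>z\<in>ball y s. z \<in> G x \<and> z \<in> G y"
  proof (rule ccontr)
    assume "\<not> ?thesis"
    then have "ball y s \<subseteq> (ball y s - G y) \<union> (ball x (2 * s) - G x)"
      using sub(1) by blast
    then have "\<mu> (ball y s) \<le> \<mu> (ball y s - G y) + \<mu> (ball x (2 * s) - G x)"
      by (rule order_trans[OF mu_mono mu_Un])
    also have "\<dots> \<le> ennreal e * \<mu> (ball y s) + ennreal e * \<mu> (ball x (2 * s))"
      using small by (intro add_mono)
    also have "\<dots> \<le> ennreal e * \<mu> (ball y s) + ennreal e * (ennreal (K\<^sup>2) * \<mu> (ball y s))"
      using mu_mono[OF sub(2)] ball_triple[OF s(1), of y]
      by (intro add_left_mono mult_left_mono) (auto intro: order_trans)
    also have "\<dots> = ennreal (e + e * K\<^sup>2) * \<mu> (ball y s)"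
      using e(1) by (simp add: ennreal_mult distrib_right mult.assoc)
    also have "\<dots> < \<mu> (ball y s)"
      unfolding e(2) using s(1) by (rule half_ball_less)
    finally show False by simp
  qed
  then obtain z where z: "dist y z < s" "dist (f z) (f x) \<le> real (Suc k) * dist z x"
    "dist (f z) (f y) \<le> real (Suc k) * dist z y"
    by (auto simp: G_def)
  have "dist z x \<le> 2 * s" "dist z y \<le> s"
    using z(1) dist_triangle[of z x y] by (simp_all add: s_def dist_commute)
  then have "real (Suc k) * dist z x \<le> real (Suc k) * (2 * s)" "real (Suc k) * dist z y \<le> real (Suc k) * s"
    by (intro mult_left_mono; simp)+
  then have "dist (f x) (f y) \<le> real (Suc k) * (2 * s) + real (Suc k) * s"
    using z(2,3) dist_triangle3[of "f x" "f y" "f z"] by linarith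
  then show ?thesis by (simp add: s_def algebra_simps)
qed simp

section \<open>Density points of hulls and Lipschitz extension to the closure\<close>

text \<open>If S missed E in a small ball, the part of S there would lie in the complement of E and
  have at most a quarter of the mass. The hull property gives H the same bound, and the complement
  of H adds at most another quarter, too little to fill the ball.\<close>

lemma hull_meets:
  assumes hull: "\<And>T. mu_measurable \<mu> T \<Longrightarrow> \<mu> (H \<inter> T) = \<mu> (S \<inter> T)"
    and "density_point H y" "density_point E y" "\<epsilon> > 0"
  obtains z where "z \<in> S" "z \<in> E" "dist z y < \<epsilon>"
proof -
  have "\<forall>\<^sub>F r in at_right 0. \<mu> (ball y r - H) \<le> ennreal (1/4) * \<mu> (ball y r)"
    "\<forall>\<^sub>F r in at_right 0. \<mu> (ball y r - E) \<le> ennreal (1/4) * \<mu> (ball y r)"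
    using assms(2,3) unfolding density_point_def by (meson zero_less_divide_1_iff zero_less_numeral)+
  moreover have "\<forall>\<^sub>F r in at_right 0. r \<in> {0<..<\<epsilon>}"
    by (rule eventually_at_right_real) (rule assms)
  ultimately have "\<forall>\<^sub>F r in at_right 0. r < \<epsilon> \<and> (\<exists>z. z \<in> S \<and> z \<in> E \<and> dist z y < r)"
  proof eventually_elim
    case (elim r)
    have "\<exists>z. z \<in> S \<and> z \<in> E \<and> dist z y < r"
    proof (rule ccontr)
      assume "\<not> ?thesis"
      then have "S \<inter> ball y r \<subseteq> ball y r - E"
        by (auto simp: dist_commute)
      then have "\<mu> (S \<inter> ball y r) \<le> ennreal (1/4) * \<mu> (ball y r)"
        by (rule order_trans[OF mu_mono elim(2)])
      then have "\<mu> (H \<inter> ball y r) \<le> ennreal (1/4) * \<mu> (ball y r)"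
        using hull[of "ball y r"] borel_measurable by simp
      then have "\<mu> (H \<inter> ball y r) + \<mu> (ball y r - H)
          \<le> ennreal (1/4) * \<mu> (ball y r) + ennreal (1/4) * \<mu> (ball y r)"
        using elim(1) by (rule add_mono)
      moreover have "\<mu> (ball y r) \<le> \<mu> (H \<inter> ball y r) + \<mu> (ball y r - H)"
        by (rule order_trans[OF mu_mono mu_Un]) blast
      ultimately have "\<mu> (ball y r) \<le> (ennreal (1/4) + ennreal (1/4)) * \<mu> (ball y r)"
        by (simp add: distrib_right)
      also have "\<dots> = ennreal (1/2) * \<mu> (ball y r)"
        by (simp flip: ennreal_plus)
      also have "\<dots> < \<mu> (ball y r)"
        using elim(3) by (intro half_ball_less) simp
      finally show False by simp
    qed
    then show ?case using elim(3) by simp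
  qed
  then obtain r where "r < \<epsilon>" "\<exists>z. z \<in> S \<and> z \<in> E \<and> dist z y < r"
    using eventually_happens'[OF trivial_limit_at_right_real] by blast
  then show ?thesis using that less_trans by blast
qed

text \<open>Points z of S tend to y inside a neighbourhood where the slope of f at y is bounded.
  Along them \<open>f z\<close> tends to \<open>f y\<close>, while \<open>f z = g z\<close> tends to
  \<open>g y\<close> by the Lipschitz bound.\<close>

lemma agrees_with_extension:
  fixes f g :: "'a \<Rightarrow> 'b::metric_space"
  assumes hull: "\<And>T. mu_measurable \<mu> T \<Longrightarrow> \<mu> (H \<inter> T) = \<mu> (S \<inter> T)"
    and "S \<subseteq> A" "density_point H y" "y \<in> A_f_mu \<mu> A f"
    and g: "L-lipschitz_on (closure S) g" "\<And>x. x \<in> S \<Longrightarrow> g x = f x"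
  shows "y \<in> closure S \<and> g y = f y"
proof -
  obtain U L' where U: "L' \<ge> 0" "mu_nbhd \<mu> y U"
    "\<And>z. z \<in> U \<inter> A \<Longrightarrow> dist (f z) (f y) \<le> L' * dist z y"
    using A_f_mu_D[OF assms(4)] by blast
  have "density_point U y" using U(2) by (simp add: mu_nbhd_iff)
  note meets = hull_meets[OF hull \<open>density_point H y\<close> this]
  have "y \<in> closure S"
    unfolding closure_approachable using meets by metis
  have "L \<ge> 0" using g(1) by (rule lipschitz_on_nonneg)
  have "dist (g y) (f y) \<le> 0 + e" if "e > 0" for e
  proof -
    \<comment> \<open>The summand 1 keeps the denominator positive when both Lipschitz constants
      vanish.\<close>
    define d where "d = e / (L + L' + 1)"
    have "d > 0" using that \<open>L \<ge> 0\<close> \<open>L' \<ge> 0\<close> by (simp add: d_def)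
    then obtain z where z: "z \<in> S" "z \<in> U" "dist z y < d" using meets by blast
    have "dist (g y) (g z) \<le> L * dist y z"
      using z(1) \<open>y \<in> closure S\<close> closure_subset[of S] by (intro lipschitz_onD[OF g(1)]) auto
    moreover have "dist (f z) (f y) \<le> L' * dist z y"
      using z(1,2) \<open>S \<subseteq> A\<close> by (intro U(3)) auto
    ultimately have "dist (g y) (f y) \<le> (L + L') * dist z y"
      using dist_triangle[of "g y" "f y" "f z"] g(2)[OF z(1)]
      by (simp add: dist_commute algebra_simps)
    also have "\<dots> \<le> (L + L') * d"
      using z(3) \<open>L \<ge> 0\<close> \<open>L' \<ge> 0\<close> by (intro mult_left_mono) auto
    also have "\<dots> \<le> (L + L' + 1) * d"
      using \<open>d > 0\<close> by (simp add: algebra_simps)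
    also have "\<dots> = e" using \<open>L \<ge> 0\<close> \<open>L' \<ge> 0\<close> by (simp add: d_def)
    finally show ?thesis by simp
  qed
  then have "dist (g y) (f y) \<le> 0" by (rule field_le_epsilon)
  with \<open>y \<in> closure S\<close> show ?thesis by simp
qed

text \<open>Completeness is applied to g on \<open>closure S\<close>, but tested on the measurable
  set U rather than on S. Every point of U is a density point of U and f = g there, so the result
  transfers back to f with U as neighbourhood.\<close>

lemma null_not_diff_on_lipschitz:
  fixes f :: "'a \<Rightarrow> 'b::{metric_space, complete_space}"
  assumes dc: "differentiably_complete \<mu> D"
    and B: "mu_measurable \<mu> B" "B \<subseteq> A_f_mu \<mu> A f"
    and S: "S \<subseteq> B" "\<mu> S < top" "L-lipschitz_on S f"
  shows "\<mu> {x \<in> S. \<not> approx_D_diff_at \<mu> D A f x} = 0"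
proof (cases "S = {}")
  case False
  obtain g where g: "L-lipschitz_on (closure S) g" "\<And>x. x \<in> S \<Longrightarrow> g x = f x"
    using lipschitz_extend_closure[OF S(3)] by blast
  obtain H where H: "H \<in> sets borel" "S \<subseteq> H"
    "\<And>T. mu_measurable \<mu> T \<Longrightarrow> \<mu> (H \<inter> T) = \<mu> (S \<inter> T)"
    using borel_hull[OF S(2)] by metis
  have BA: "y \<in> A" "mu_acc \<mu> A y" if "y \<in> B" for y
    using B(2) that by (auto simp: A_f_mu_def)
  define N where "N = {y \<in> H. \<not> density_point H y} \<union> {y \<in> B. \<not> density_point B y}"
  have N: "\<mu> N = 0"
    unfolding N_def using lebesgue_density H(1) B(1) borel_measurable by (intro null_Un) auto
  define U where "U = H \<inter> B - N"
  have U_measurable: "mu_measurable \<mu> U"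
    unfolding U_def using H(1) B(1) N borel_measurable by (intro measurable_diff_null measurable_Int) auto
  have U_density_point: "density_point U y" if "y \<in> U" for y
  proof (rule density_point_modulo_null)
    show "density_point (H \<inter> B) y" using that by (intro density_point_Int) (auto simp: U_def N_def)
    show "\<mu> (H \<inter> B - U) = 0" using N by (rule null_subset) (auto simp: U_def)
  qed
  have U_eq: "y \<in> closure S \<and> g y = f y" if "y \<in> U" for y
  proof (rule agrees_with_extension[OF H(3) _ _ _ g])
    show "S \<subseteq> A" using S(1) BA(1) by blast
    show "density_point H y" using that by (auto simp: U_def N_def)
    show "y \<in> A_f_mu \<mu> A f" using that B(2) by (auto simp: U_def)
  qed
  have "U \<subseteq> A_f_mu \<mu> (closure S) g"
  proof
    fix y assume y: "y \<in> U"
    have "density_point (closure S) y"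
      using U_eq by (intro density_point_mono[OF U_density_point[OF y]]) blast
    moreover have "y \<in> closure S" using U_eq y by blast
    \<comment> \<open>Accumulation is known relative to A; density of \<open>closure S\<close> at y
      turns it into accumulation of \<open>closure S\<close>.\<close>
    moreover have "mu_acc \<mu> A y" using y BA(2) by (auto simp: U_def)
    ultimately show "y \<in> A_f_mu \<mu> (closure S) g"
      using g(1) by (intro A_f_mu_I[where U = "closure S" and L = L])
        (auto simp: mu_nbhd_iff intro: mu_acc_density_point lipschitz_onD)
  qed
  moreover have "ae_approx_D_diff \<mu> D (closure S) g"
    using dc False g(1) unfolding differentiably_complete_def by auto
  ultimately have "\<mu> {x \<in> U. \<not> approx_D_diff_at \<mu> D (closure S) g x} = 0"
    using U_measurable unfolding ae_approx_D_diff_def by blast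
  with N have "\<mu> (N \<union> {x \<in> U. \<not> approx_D_diff_at \<mu> D (closure S) g x}) = 0"
    by (rule null_Un)
  moreover have "approx_D_diff_at \<mu> D A f x"
    if "x \<in> U" "approx_D_diff_at \<mu> D (closure S) g x" for x
  proof (rule approx_D_diff_at_transfer[OF that(2)])
    show "x \<in> A" "mu_acc \<mu> A x" using that(1) BA by (auto simp: U_def)
    show "mu_nbhd \<mu> x U" using that(1) U_density_point by (simp add: mu_nbhd_iff)
  qed (use U_eq in blast)
  \<comment> \<open>Since S lies in both H and B, each of its points is in N or in U.\<close>
  then have "{x \<in> S. \<not> approx_D_diff_at \<mu> D A f x}
      \<subseteq> N \<union> {x \<in> U. \<not> approx_D_diff_at \<mu> D (closure S) g x}"
    using S(1) H(2) by (auto simp: U_def)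
  ultimately show ?thesis by (rule null_subset)
qed simp

section \<open>The two implications\<close>

text \<open>Up to the null set of points of B that are not density points, B is covered by the
  pieces; cutting these with small balls about a countable dense set yields countably many sets to
  which the Lipschitz case applies.\<close>

lemma ae_diff_if_complete:
  fixes f :: "'a \<Rightarrow> 'b::{metric_space, complete_space}"
  assumes dc: "differentiably_complete \<mu> D"
  shows "ae_approx_D_diff \<mu> D A f"
  unfolding ae_approx_D_diff_def
proof (intro allI impI)
  fix B assume B: "B \<subseteq> A_f_mu \<mu> A f" "mu_measurable \<mu> B"
  let ?bad = "\<lambda>S. {x \<in> S. \<not> approx_D_diff_at \<mu> D A f x}"
  obtain Q :: "'a set" where Q: "countable Q" "\<And>X. open X \<Longrightarrow> X \<noteq> {} \<Longrightarrow> \<exists>q\<in>Q. q \<in> X"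
    by (rule countable_dense_setE) blast
  define c where "c k = 1 / real (Suc k)" for k
  have c_pos: "c k > 0" for k by (simp add: c_def)
  \<comment> \<open>Radius \<open>c k / 4\<close> makes any two points of the set closer than
    \<open>c k / 2\<close>, the range required by \<open>piece_lipschitz\<close>. The ball also
    gives the finite measure needed for a Borel hull.\<close>
  define S where "S k q = piece f B k \<inter> ball q (c k / 4)" for k q
  have "\<mu> (?bad (S k q)) = 0" for k q
  proof (rule null_not_diff_on_lipschitz[OF dc B(2,1)])
    show "S k q \<subseteq> B" by (auto simp: S_def piece_def)
    have "\<mu> (S k q) \<le> \<mu> (ball q (c k / 4))"
      by (rule mu_mono) (simp add: S_def)
    also have "\<dots> < top" using c_pos by (intro ball_finite) simp
    finally show "\<mu> (S k q) < top" .
    show "(3 * real (Suc k))-lipschitz_on (S k q) f"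
    proof (rule lipschitz_onI)
      fix x y assume xy: "x \<in> S k q" "y \<in> S k q"
      then have "2 * dist x y < c k"
        using dist_triangle3[of x y q] by (simp add: S_def)
      then show "dist (f x) (f y) \<le> 3 * real (Suc k) * dist x y"
        using xy unfolding c_def by (intro piece_lipschitz) (auto simp: S_def)
    qed simp
  qed
  then have "\<mu> (\<Union>k. \<Union>q\<in>Q. ?bad (S k q)) = 0"
    by (intro null_UN null_UN_countable Q(1))
  then have "\<mu> ({x \<in> B. \<not> density_point B x} \<union> (\<Union>k. \<Union>q\<in>Q. ?bad (S k q))) = 0"
    using lebesgue_density[OF B(2)] by (intro null_Un)
  moreover have "?bad B \<subseteq> {x \<in> B. \<not> density_point B x} \<union> (\<Union>k. \<Union>q\<in>Q. ?bad (S k q))"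
  proof
    fix x assume x: "x \<in> ?bad B"
    show "x \<in> {x \<in> B. \<not> density_point B x} \<union> (\<Union>k. \<Union>q\<in>Q. ?bad (S k q))"
    proof (cases "density_point B x")
      case True
      have "B \<subseteq> A" using B(1) by (auto simp: A_f_mu_def)
      then obtain k where k: "x \<in> piece f B k"
        using piece_cover[of x B A f] True x B(1) by blast
      obtain q where "q \<in> Q" "q \<in> ball x (c k / 4)"
        using Q(2)[of "ball x (c k / 4)"] c_pos[of k] by auto
      then have "x \<in> ?bad (S k q)" using k x by (simp add: S_def dist_commute)
      with \<open>q \<in> Q\<close> show ?thesis by blast
    qed (use x in blast)
  qed
  ultimately show "\<mu> (?bad B) = 0" by (rule null_subset)
qed

text \<open>As a total function g is already defined on the whole space, with arbitrary values off
  C. At a density point of C in C the set C is a neighbourhood, so those values affect neither the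
  finite slope nor the derivative.\<close>

lemma complete_if_ae_diff:
  fixes D :: "('a \<times> 'b::metric_space \<times> ('a set \<times> ('a \<Rightarrow> 'b)) set) set"
  assumes ae: "\<And>f :: 'a \<Rightarrow> 'b. ae_approx_D_diff \<mu> D UNIV f"
  shows "differentiably_complete \<mu> D"
  unfolding differentiably_complete_def ae_approx_D_diff_def
proof (intro allI impI, elim exE)
  fix C and g :: "'a \<Rightarrow> 'b" and B L
  assume C: "closed C" and g: "L-lipschitz_on C g"
    and B: "B \<subseteq> A_f_mu \<mu> C g" "mu_measurable \<mu> B"
  define N where "N = {x \<in> C. \<not> density_point C x}"
  have N: "\<mu> N = 0"
    unfolding N_def using C by (intro lebesgue_density borel_measurable borel_closed)
  have BC: "x \<in> C" "mu_acc \<mu> C x" if "x \<in> B" for x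
    using B(1) that by (auto simp: A_f_mu_def)
  have "B - N \<subseteq> A_f_mu \<mu> UNIV g"
  proof
    fix x assume x: "x \<in> B - N"
    then have "density_point C x" "x \<in> C" using BC by (auto simp: N_def)
    moreover have "mu_acc \<mu> UNIV x" using BC(2)[of x] x by (auto simp: mu_acc_def)
    ultimately show "x \<in> A_f_mu \<mu> UNIV g"
      using g by (intro A_f_mu_I[where U = C and L = L])
        (auto simp: mu_nbhd_iff intro: lipschitz_onD)
  qed
  then have "\<mu> {x \<in> B - N. \<not> approx_D_diff_at \<mu> D UNIV g x} = 0"
    using ae[of g] measurable_diff_null[OF B(2) N] unfolding ae_approx_D_diff_def by blast
  with N have "\<mu> (N \<union> {x \<in> B - N. \<not> approx_D_diff_at \<mu> D UNIV g x}) = 0"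
    by (rule null_Un)
  moreover have "approx_D_diff_at \<mu> D C g x"
    if "x \<in> B - N" "approx_D_diff_at \<mu> D UNIV g x" for x
  proof (rule approx_D_diff_at_transfer[OF that(2)])
    show "x \<in> C" "mu_acc \<mu> C x" using that(1) BC by auto
    show "mu_nbhd \<mu> x C" using that(1) BC by (auto simp: mu_nbhd_iff N_def)
  qed simp
  then have "{x \<in> B. \<not> approx_D_diff_at \<mu> D C g x}
      \<subseteq> N \<union> {x \<in> B - N. \<not> approx_D_diff_at \<mu> D UNIV g x}"
    by blast
  ultimately show "\<mu> {x \<in> B. \<not> approx_D_diff_at \<mu> D C g x} = 0"
    by (rule null_subset)
qed

end

theorem theorem2p8:
  fixes K :: real
    and \<mu> :: "'a::polish_space set \<Rightarrow> ennreal"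
    and D :: "('a \<times> 'b::{metric_space, complete_space} \<times> ('a set \<times> ('a \<Rightarrow> 'b)) set) set"
  assumes "doubling_mms K \<mu>"
    and "approx_distribution \<mu> D"
  shows "(differentiably_complete \<mu> D \<longrightarrow>
            (\<forall>A (f :: 'a \<Rightarrow> 'b). A \<noteq> {} \<longrightarrow> ae_approx_D_diff \<mu> D A f))
       \<and> ((\<forall>f :: 'a \<Rightarrow> 'b. ae_approx_D_diff \<mu> D UNIV f) \<longrightarrow> differentiably_complete \<mu> D)"
proof -
  interpret doubling_space K \<mu>
    by unfold_locales (rule assms(1))
  show ?thesis
    using ae_diff_if_complete complete_if_ae_diff by blast
qed

end
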